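(* Let $(G,\rho,V(3))$ be a 3-dimensional prehomogeneous vector space. For every 4-simple prehomogeneous vector space $$(G\times GL(m_1)\times SL(m_2)\times SL(m_3),\ \rho\otimes\Lambda_1\otimes\Lambda_1\otimes\Lambda_1,\ V(3)\otimes V(m_1)\otimes V(m_2)\otimes V(m_3))$$ (abbreviated $(3,m_1,m_2,m_3)$) in the tree of castling transforms of the seed prehomogeneous vector space $(G\times GL(1),\rho\otimes\Lambda_1,V(3)\otimes V(1))$, the triple of integers $(m_1,m_2,m_3)$ satisfies $$m_1^2+m_2^2+m_3^2=3m_1m_2m_3 .$$ Namely, $(m_1,m_2,m_3)$ is a Markov triple.
   Context: A triplet $(G,\rho,V)$, with $G$ a linear algebraic group over $\mathbb{C}$ and $\rho$ a rational representation of $G$ on a finite-dimensional complex vector space $V$, is a prehomogeneous vector space (PV) if $V$ has a Zariski-dense $G$-orbit. $V(n)$ denotes an $n$-dimensional vector space and $\Lambda_1$ the standard representation of $GL(n)$ or $SL(n)$ on $V(n)$. Castling transform: if $\rho:G\to GL(V)$ with $\dim V=m>n\ge1$, then $(G\times GL(n),\rho\otimes\Lambda_1,V\otimes V(n))$ and $(G\times GL(m-n),\rho^*\otimes\Lambda_1,V^*\otimes V(m-n))$ are called castling transforms of each other; one is a PV if and only if the other is. The triplet $(G\times SL(m_1)\times\cdots\times SL(m_{n-1})\times GL(m_n),\ \rho\otimes\Lambda_1\otimes\cdots\otimes\Lambda_1,\ V(3)\otimes V(m_1)\otimes\cdots\otimes V(m_n))$ is abbreviated $(3,m_1,\dots,m_n)$;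 it does not matter which factor carries the scalars $GL(1)$ (i.e. which of the factors is written as $GL$ instead of $SL$), the order of $m_1,\dots,m_n$ is irrelevant, and entries equal to $1$ may be inserted or deleted. The tree of castling transforms of the seed $(3,1)$ consists of all triplets obtained from the seed by finitely many successive castling transformations; in terms of the abbreviation these are the operations $$(3,m_1,\dots,m_n)\mapsto\Big(3,m_1,\dots,m_{i-1},\,3\prod_{j\ne i}m_j-m_i,\,m_{i+1},\dots,m_n\Big)$$ (where, using an inserted entry $1$, this includes $(3,m_1,\dots,m_n)\mapsto(3,m_1,\dots,m_n,3\prod_j m_j-1)$). A Markov triple is a triple $(x,y,z)$ of positive integers with $x^2+y^2+z^2=3xyz$. *)

theory Defs
  imports
    "Jordan_Normal_Form.Determinant"
    "HOL-Library.Multiset"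
begin

section \<open>Linear algebraic groups and rational representations\<close>

text \<open>The algebra of functions generated by the constants and a set \<open>X\<close> of coordinate functions.\<close>

inductive polynomial_in :: "('a \<Rightarrow> complex) set \<Rightarrow> ('a \<Rightarrow> complex) \<Rightarrow> bool"
  for X :: "('a \<Rightarrow> complex) set" where
  coord: "f \<in> X \<Longrightarrow> polynomial_in X f"
| const: "polynomial_in X (\<lambda>_. c)"
| add: "polynomial_in X f \<Longrightarrow> polynomial_in X g \<Longrightarrow> polynomial_in X (\<lambda>x. f x + g x)"
| mult: "polynomial_in X f \<Longrightarrow> polynomial_in X g \<Longrightarrow> polynomial_in X (\<lambda>x. f x * g x)"

definition mat_coords :: "nat \<Rightarrow> (complex mat \<Rightarrow> complex) set" where
  "mat_coords n = {\<lambda>A. A $$ (i, j) | i j. i < n \<and> j < n}"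

definition vec_coords :: "nat \<Rightarrow> (complex vec \<Rightarrow> complex) set" where
  "vec_coords n = {\<lambda>v. v $ i | i. i < n}"

definition GL :: "nat \<Rightarrow> complex mat monoid" where
  "GL n = units_of (ring_mat TYPE(complex) n ())"

definition SL :: "nat \<Rightarrow> complex mat set" where
  "SL n = {A \<in> carrier_mat n n. det A = 1}"

text \<open>A linear algebraic group is a Zariski-closed subgroup of some \<open>GL N\<close>.\<close>

definition linear_algebraic_group :: "nat \<Rightarrow> complex mat set \<Rightarrow> bool" where
  "linear_algebraic_group N G \<longleftrightarrow>
     subgroup G (GL N) \<and>
     (\<exists>P. (\<forall>p\<in>P. polynomial_in (mat_coords N) p) \<and>
          G = {A \<in> carrier (GL N). \<forall>p\<in>P. p A = 0})"

text \<open>The coordinate ring of a closed subgroup of \<open>GL N\<close> is generated by the matrix entries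
  and the inverse of the determinant.\<close>

definition regular_on :: "nat \<Rightarrow> complex mat set \<Rightarrow> (complex mat \<Rightarrow> complex) \<Rightarrow> bool" where
  "regular_on N G f \<longleftrightarrow>
     (\<exists>p k. polynomial_in (mat_coords N) p \<and> (\<forall>A\<in>G. f A = p A / det A ^ k))"

definition rational_representation ::
  "nat \<Rightarrow> complex mat set \<Rightarrow> nat \<Rightarrow> (complex mat \<Rightarrow> complex mat) \<Rightarrow> bool" where
  "rational_representation N G d \<rho> \<longleftrightarrow>
     \<rho> \<in> hom (GL N\<lparr>carrier := G\<rparr>) (GL d) \<and>
     (\<forall>i<d. \<forall>j<d. regular_on N G (\<lambda>A. \<rho> A $$ (i, j)))"

section \<open>Prehomogeneous vector spaces\<close>

text \<open>A triplet \<open>(G, \<rho>, V)\<close> in coordinates: \<open>G = grp\<close> is a set of matrices of size \<open>gdim\<close>, and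
  \<open>V\<close> is the space of column vectors of length \<open>vdim\<close>.\<close>

record triplet =
  gdim :: nat
  grp :: "complex mat set"
  rep :: "complex mat \<Rightarrow> complex mat"
  vdim :: nat

definition zariski_dense :: "nat \<Rightarrow> complex vec set \<Rightarrow> bool" where
  "zariski_dense d S \<longleftrightarrow>
     (\<forall>p. polynomial_in (vec_coords d) p \<longrightarrow> (\<forall>v\<in>S. p v = 0) \<longrightarrow> (\<forall>v\<in>carrier_vec d. p v = 0))"

definition prehomogeneous :: "triplet \<Rightarrow> bool" where
  "prehomogeneous T \<longleftrightarrow>
     linear_algebraic_group (gdim T) (grp T) \<and>
     rational_representation (gdim T) (grp T) (vdim T) (rep T) \<and>
     (\<exists>v\<in>carrier_vec (vdim T). zariski_dense (vdim T) ((\<lambda>g. rep T g *\<^sub>v v) ` grp T))"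

text \<open>Equivalence of triplets: the images of the two groups correspond to each other under a linear
  isomorphism of the two spaces.\<close>

definition equivalent :: "triplet \<Rightarrow> triplet \<Rightarrow> bool" where
  "equivalent T T' \<longleftrightarrow>
     vdim T = vdim T' \<and>
     (\<exists>P\<in>carrier (GL (vdim T)).
        (\<lambda>g. P * rep T g * inv\<^bsub>GL (vdim T)\<^esub> P) ` grp T = rep T' ` grp T')"

section \<open>Tensor products with standard representations, and duals\<close>

definition kronecker :: "complex mat \<Rightarrow> complex mat \<Rightarrow> complex mat" where
  "kronecker A B = mat (dim_row A * dim_row B) (dim_col A * dim_col B)
     (\<lambda>(i, j). A $$ (i div dim_row B, j div dim_col B) * B $$ (i mod dim_row B, j mod dim_col B))"

text \<open>\<open>tensor_std T K n\<close> is \<open>(G \<times> K, \<rho> \<otimes> \<Lambda>\<^sub>1, V \<otimes> V(n))\<close> for a group \<open>K\<close> of \<open>n \<times> n\<close> matrices; the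
  product of groups is realised by block diagonal matrices.\<close>

definition tensor_std :: "triplet \<Rightarrow> complex mat set \<Rightarrow> nat \<Rightarrow> triplet" where
  "tensor_std T K n = \<lparr>
     gdim = gdim T + n,
     grp = {four_block_mat g (0\<^sub>m (gdim T) n) (0\<^sub>m n (gdim T)) A | g A. g \<in> grp T \<and> A \<in> K},
     rep = (\<lambda>X. case split_block X (gdim T) (gdim T) of (g, _, _, A) \<Rightarrow> kronecker (rep T g) A),
     vdim = vdim T * n \<rparr>"

abbreviation tensor_GL :: "triplet \<Rightarrow> nat \<Rightarrow> triplet" where
  "tensor_GL T n \<equiv> tensor_std T (carrier (GL n)) n"

abbreviation tensor_SL :: "triplet \<Rightarrow> nat \<Rightarrow> triplet" where
  "tensor_SL T n \<equiv> tensor_std T (SL n) n"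

definition dual_triplet :: "triplet \<Rightarrow> triplet" where
  "dual_triplet T = T\<lparr>rep := \<lambda>g. transpose_mat (inv\<^bsub>GL (vdim T)\<^esub> (rep T g))\<rparr>"

text \<open>For \<open>T = (G, \<rho>, V)\<close>, \<open>multi_triplet T [m\<^sub>1, \<dots>, m\<^sub>n]\<close> is
  \<open>(G \<times> SL(m\<^sub>1) \<times> \<dots> \<times> SL(m\<^sub>n\<^sub>-\<^sub>1) \<times> GL(m\<^sub>n), \<rho> \<otimes> \<Lambda>\<^sub>1 \<otimes> \<dots> \<otimes> \<Lambda>\<^sub>1, V \<otimes> V(m\<^sub>1) \<otimes> \<dots> \<otimes> V(m\<^sub>n))\<close>.\<close>

fun multi_triplet :: "triplet \<Rightarrow> nat list \<Rightarrow> triplet" where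
  "multi_triplet T [] = T"
| "multi_triplet T [n] = tensor_GL T n"
| "multi_triplet T (m # n # ms) = multi_triplet (tensor_SL T m) (n # ms)"

section \<open>The tree of castling transforms\<close>

text \<open>Equality of abbreviations up to the order of the entries and inserted or deleted entries 1.\<close>

definition same_abbreviation :: "nat list \<Rightarrow> nat list \<Rightarrow> bool" where
  "same_abbreviation ms ms' \<longleftrightarrow>
     mset (filter (\<lambda>m. m \<noteq> 1) ms) = mset (filter (\<lambda>m. m \<noteq> 1) ms')"

text \<open>\<open>castling_tree T ms S\<close>: the triplet \<open>S\<close>, abbreviated \<open>(3, ms)\<close> when \<open>vdim T = 3\<close>, belongs to the tree
  of castling transforms of the seed \<open>(G \<times> GL(1), \<rho> \<otimes> \<Lambda>\<^sub>1, V \<otimes> V(1))\<close>, where \<open>T = (G, \<rho>, V)\<close>.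
  The abbreviation is carried along since a triplet alone need not determine which
  of its factors are the displayed ones. A castling transform
  replaces the representation of the remaining group by its dual. On the factors \<open>SL(m)\<close> this is undone by
  the automorphism inverse transpose, but \<open>\<rho>\<^sup>*\<close> and \<open>\<rho>\<close> need not give equivalent triplets; hence
  the nodes are, up to equivalence, of the form \<open>multi_triplet\<close> of \<open>T\<close> or of its dual.
  The third rule identifies nodes that differ in the factor carrying the scalars, in the order
  of the factors, by factors for entries 1, or by the automorphism above.\<close>

inductive castling_tree :: "triplet \<Rightarrow> nat list \<Rightarrow> triplet \<Rightarrow> bool" for T :: triplet where
  seed: "castling_tree T [1] (tensor_GL T 1)"
| castling:
    "castling_tree T (ms @ [n]) (tensor_GL C n) \<Longrightarrow> 1 \<le> n \<Longrightarrow> n < vdim C \<Longrightarrow>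
     castling_tree T (ms @ [vdim C - n]) (tensor_GL (dual_triplet C) (vdim C - n))"
| identify:
    "castling_tree T ms S \<Longrightarrow> equivalent S (multi_triplet T' ms') \<Longrightarrow> T' \<in> {T, dual_triplet T} \<Longrightarrow>
     same_abbreviation ms ms' \<Longrightarrow> ms' \<noteq> [] \<Longrightarrow>
     castling_tree T ms' (multi_triplet T' ms')"

definition markov_triple :: "nat \<Rightarrow> nat \<Rightarrow> nat \<Rightarrow> bool" where
  "markov_triple x y z \<longleftrightarrow> 0 < x \<and> 0 < y \<and> 0 < z \<and> x\<^sup>2 + y\<^sup>2 + z\<^sup>2 = 3 * x * y * z"

end

(* The idea is that dim G - dim V is invariant under castling: the number
     (m_1^2 - 1) + ... + (m_n^2 - 1) - 3 m_1 ... m_n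
   does not change when m_i is replaced by 3 (PROD j ~= i. m_j) - m_i, the other root of a monic
   quadratic polynomial, nor when entries 1 are inserted or deleted. It is -3 at the seed (3,1), and
   for n = 3 the value -3 is Markov's equation. *)
theory Submission
  imports Defs
begin

text \<open>Each summand is dim SL(m). The dimension of the group of the seed and the 1 for the
  scalars are left out, being constant on the tree.\<close>

definition castling_invariant :: "nat list \<Rightarrow> int" where
  "castling_invariant ms = (\<Sum>m\<leftarrow>ms. (int m)\<^sup>2 - 1) - 3 * int (prod_list ms)"

lemma vdim_tensor_std [simp]: "vdim (tensor_std T K n) = vdim T * n"
  by (simp add: tensor_std_def)

lemma vdim_dual_triplet [simp]: "vdim (dual_triplet T) = vdim T"
  by (simp add: dual_triplet_def)

lemma vdim_multi_triplet: "vdim (multi_triplet T ms) = vdim T * prod_list ms"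
  by (induction T ms rule: multi_triplet.induct) simp_all

lemma prod_list_filter_neq_1: "prod_list (filter (\<lambda>m. m \<noteq> 1) ms) = prod_list (ms :: nat list)"
  by (induction ms) auto

text \<open>An entry 1 contributes 1 - 1 = 0 to the sum and a factor 1 to the product.\<close>

lemma castling_invariant_filter_neq_1:
  "castling_invariant (filter (\<lambda>m. m \<noteq> 1) ms) = castling_invariant ms"
proof -
  have "(\<Sum>m\<leftarrow>filter (\<lambda>m. m \<noteq> 1) ms. (int m)\<^sup>2 - 1) = (\<Sum>m\<leftarrow>ms. (int m)\<^sup>2 - 1)"
    by (induction ms) auto
  then show ?thesis
    by (simp only: castling_invariant_def prod_list_filter_neq_1)
qed

lemma castling_invariant_mset_cong:
  assumes "mset ms = mset ms'"
  shows "castling_invariant ms = castling_invariant ms'"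
proof -
  have "(\<Sum>m\<leftarrow>ms. (int m)\<^sup>2 - 1) = (\<Sum>m\<leftarrow>ms'. (int m)\<^sup>2 - 1)"
    using assms by (metis mset_map sum_mset_sum_list)
  moreover have "prod_list ms = prod_list ms'"
    using assms by (metis prod_mset_prod_list)
  ultimately show ?thesis
    by (simp add: castling_invariant_def)
qed

lemma same_abbreviation_castling_invariant:
  assumes "same_abbreviation ms ms'"
  shows "castling_invariant ms = castling_invariant ms'"
  using castling_invariant_mset_cong[OF assms[unfolded same_abbreviation_def]]
  by (simp only: castling_invariant_filter_neq_1)

text \<open>Only entries 1 are filtered out, so a 0 would survive on either side. This carries
  positivity through \<open>identify\<close>.\<close>

lemma same_abbreviation_0_notin:
  assumes "same_abbreviation ms ms'" and "0 \<notin> set ms"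
  shows "0 \<notin> set ms'"
proof -
  have "set (filter (\<lambda>m. m \<noteq> 1) ms) = set (filter (\<lambda>m. m \<noteq> 1) ms')"
    using assms(1) unfolding same_abbreviation_def by (rule mset_eq_setD)
  then show ?thesis
    using assms(2) by auto
qed

text \<open>With p = \<open>3 * prod_list ms\<close>, the invariant depends on the last entry x as
  x^2 - p x plus a constant, which is symmetric under x -> p - x. The hypothesis keeps the
  subtraction in \<open>nat\<close> from truncating.\<close>

lemma castling_invariant_castle:
  assumes "n \<le> 3 * prod_list ms"
  shows "castling_invariant (ms @ [3 * prod_list ms - n]) = castling_invariant (ms @ [n])"
proof -
  have "int (3 * prod_list ms - n) = 3 * int (prod_list ms) - int n"
    using assms by (simp add: of_nat_diff)
  then show ?thesis
    by (simp add: castling_invariant_def algebra_simps power2_eq_square)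
qed

(* The dimension is part of the induction because it identifies vdim C in the castling rule. *)
lemma castling_tree_invariant:
  assumes "castling_tree T ms S" and "vdim T = 3"
  shows "vdim S = 3 * prod_list ms \<and> 0 \<notin> set ms \<and> castling_invariant ms = - 3"
  using assms
proof (induction rule: castling_tree.induct)
  case seed
  then show ?case
    by (simp add: castling_invariant_def)
next
  case (castling ms n C)
  \<comment> \<open>The induction hypothesis for \<open>tensor_GL C n\<close> reads
    \<open>vdim C * n = 3 * (prod_list ms * n)\<close>; the nonzero factor \<open>n\<close>
    cancels.\<close>
  then have vdim_C: "vdim C = 3 * prod_list ms"
    by simp
  \<comment> \<open>Here \<open>n < vdim C\<close> both justifies the subtraction and makes the new
    entry positive.\<close>
  with castling castling_invariant_castle[of n ms] show ?case
    by simp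
next
  case (identify ms S T' ms')
  have "vdim T' = 3"
    using identify.hyps(3) identify.prems by auto
  with identify show ?case
    using same_abbreviation_castling_invariant same_abbreviation_0_notin
    by (simp add: vdim_multi_triplet)
qed

theorem theorem3p3:
  fixes T T' :: triplet and m1 m2 m3 :: nat
  assumes "prehomogeneous T" and "vdim T = 3"
    and "T' \<in> {T, dual_triplet T}"
    and "prehomogeneous (multi_triplet T' [m1, m2, m3])"
    and "castling_tree T [m1, m2, m3] (multi_triplet T' [m1, m2, m3])"
  shows "markov_triple m1 m2 m3"
proof -
  have pos: "0 < m1" "0 < m2" "0 < m3" and "castling_invariant [m1, m2, m3] = - 3"
    using castling_tree_invariant[OF assms(5,2)] by auto
  \<comment> \<open>The three terms -1 of the sum cancel the value -3.\<close>
  then have "int (m1\<^sup>2 + m2\<^sup>2 + m3\<^sup>2) = int (3 * m1 * m2 * m3)"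
    by (simp add: castling_invariant_def)
  then have "m1\<^sup>2 + m2\<^sup>2 + m3\<^sup>2 = 3 * m1 * m2 * m3"
    by (simp only: of_nat_eq_iff)
  with pos show ?thesis
    by (simp add: markov_triple_def)
qed

end
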